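(* Let $X$ be a completely regular Hausdorff space and let $B$ be a norm-closed ideal in $C_b(X)$. Then: (a) $B$ is a band in $C_b(X)$ if and only if $B=J_F(X)$ for some closed set $F\subseteq X$ with $F=\overline{\operatorname{Int} F}$ (interior and closure in $X$). (b) $B$ is a projection band in $C_b(X)$ if and only if $B=J_F(X)$ for some clopen set $F\subseteq X$.
   Context: $C_b(X)$ is the Banach lattice of bounded continuous real-valued functions on $X$ with the supremum norm and pointwise order. Ideal means order ideal: a linear subspace $Y$ of a vector lattice $E$ such that $0\le |x|\le |y|$ with $x\in E$, $y\in Y$ implies $x\in Y$ (for norm-closed subspaces of $C_b(X)$ order ideals and algebra ideals are the same). A band $B$ in a vector lattice $E$ is an order ideal such that whenever $(x_\alpha)$ is a net in $B$ with $0\le x_\alpha\nearrow x$ in $E$ (i.e. the net is increasing with supremum $x$ in $E$), then $x\in B$. The disjoint complement of $B$ is $B^d=\{x\in E: |x|\wedge |b|=0\text{ for all } b\in B\}$; a band $B$ is a projection band if $E=B\oplus B^d$. For $F\subseteq X$, $J_F(X)=\{f\in C_b(X): f|_F\equiv 0\}$. *)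

theory Defs
  imports
    "HOL-Analysis.Analysis"
    "HOL-Library.Lattice_Algebras"
    "HOL-Library.Lub_Glb"
begin

section \<open>The vector lattice of bounded continuous functions\<close>

text \<open>
  The library equips the type of bounded continuous functions with its vector space structure
  and the supremum norm. The pointwise order and the lattice structure are added here. The
  codomain is only assumed to be linearly ordered with the order topology, so that pointwise
  maxima and minima are again bounded and continuous; the case of interest is \<^typ>\<open>real\<close>.
\<close>

instantiation bcontfun :: (topological_space, "{metric_space, order}") order
begin

definition less_eq_bcontfun :: "('a \<Rightarrow>\<^sub>C 'b) \<Rightarrow> ('a \<Rightarrow>\<^sub>C 'b) \<Rightarrow> bool"
  where "f \<le> g \<longleftrightarrow> (\<forall>x. apply_bcontfun f x \<le> apply_bcontfun g x)"

definition less_bcontfun :: "('a \<Rightarrow>\<^sub>C 'b) \<Rightarrow> ('a \<Rightarrow>\<^sub>C 'b) \<Rightarrow> bool"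
  where "(f :: 'a \<Rightarrow>\<^sub>C 'b) < g \<longleftrightarrow> f \<le> g \<and> \<not> g \<le> f"

instance
proof
  fix f g h :: "'a \<Rightarrow>\<^sub>C 'b"
  show "f < g \<longleftrightarrow> f \<le> g \<and> \<not> g \<le> f"
    by (rule less_bcontfun_def)
  show "f \<le> f"
    by (simp add: less_eq_bcontfun_def)
  show "f \<le> h" if "f \<le> g" "g \<le> h"
    using that unfolding less_eq_bcontfun_def by (meson order_trans)
  show "f = g" if "f \<le> g" "g \<le> f"
    using that unfolding less_eq_bcontfun_def by (intro bcontfun_eqI order.antisym) auto
qed

end

lemma max_bcontfun:
  fixes f g :: "'a::topological_space \<Rightarrow> 'b::{metric_space, linorder_topology}"
  assumes "f \<in> bcontfun" "g \<in> bcontfun"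
  shows "(\<lambda>x. max (f x) (g x)) \<in> bcontfun"
proof -
  have "range (\<lambda>x. max (f x) (g x)) \<subseteq> range f \<union> range g"
    by (auto simp: max_def)
  moreover have "bounded (range f \<union> range g)"
    using assms by (simp add: bcontfun_def)
  ultimately have "bounded (range (\<lambda>x. max (f x) (g x)))"
    by (rule bounded_subset[rotated])
  then show ?thesis
    using assms by (simp add: bcontfun_def continuous_on_max)
qed

lemma min_bcontfun:
  fixes f g :: "'a::topological_space \<Rightarrow> 'b::{metric_space, linorder_topology}"
  assumes "f \<in> bcontfun" "g \<in> bcontfun"
  shows "(\<lambda>x. min (f x) (g x)) \<in> bcontfun"
proof -
  have "range (\<lambda>x. min (f x) (g x)) \<subseteq> range f \<union> range g"
    by (auto simp: min_def)
  moreover have "bounded (range f \<union> range g)"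
    using assms by (simp add: bcontfun_def)
  ultimately have "bounded (range (\<lambda>x. min (f x) (g x)))"
    by (rule bounded_subset[rotated])
  then show ?thesis
    using assms by (simp add: bcontfun_def continuous_on_min)
qed

instantiation bcontfun :: (topological_space, "{metric_space, linorder_topology}") lattice
begin

definition sup_bcontfun :: "('a \<Rightarrow>\<^sub>C 'b) \<Rightarrow> ('a \<Rightarrow>\<^sub>C 'b) \<Rightarrow> 'a \<Rightarrow>\<^sub>C 'b"
  where "sup f g = Bcontfun (\<lambda>x. max (apply_bcontfun f x) (apply_bcontfun g x))"

definition inf_bcontfun :: "('a \<Rightarrow>\<^sub>C 'b) \<Rightarrow> ('a \<Rightarrow>\<^sub>C 'b) \<Rightarrow> 'a \<Rightarrow>\<^sub>C 'b"
  where "inf f g = Bcontfun (\<lambda>x. min (apply_bcontfun f x) (apply_bcontfun g x))"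

lemma apply_sup_bcontfun [simp]:
  "apply_bcontfun (sup f g) x = max (apply_bcontfun f x) (apply_bcontfun g x)"
  for f g :: "'a \<Rightarrow>\<^sub>C 'b"
  unfolding sup_bcontfun_def
  by (subst Bcontfun_inverse) (auto intro: max_bcontfun apply_bcontfun)

lemma apply_inf_bcontfun [simp]:
  "apply_bcontfun (inf f g) x = min (apply_bcontfun f x) (apply_bcontfun g x)"
  for f g :: "'a \<Rightarrow>\<^sub>C 'b"
  unfolding inf_bcontfun_def
  by (subst Bcontfun_inverse) (auto intro: min_bcontfun apply_bcontfun)

instance
  by standard (auto simp: less_eq_bcontfun_def)

end

instance bcontfun ::
  (topological_space, "{real_normed_vector, ordered_real_vector}") ordered_real_vector
  by standard (simp_all add: less_eq_bcontfun_def scaleR_left_mono scaleR_right_mono)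

instantiation bcontfun ::
  (topological_space, "{real_normed_vector, ordered_real_vector, linorder_topology}")
  lattice_ab_group_add_abs
begin

definition abs_bcontfun :: "('a \<Rightarrow>\<^sub>C 'b) \<Rightarrow> 'a \<Rightarrow>\<^sub>C 'b"
  where "\<bar>f\<bar> = sup f (- f)" for f :: "'a \<Rightarrow>\<^sub>C 'b"

instance
  by standard (rule abs_bcontfun_def)

end

lemma apply_abs_bcontfun [simp]:
  "apply_bcontfun \<bar>f\<bar> x = \<bar>apply_bcontfun f x\<bar>" for f :: "'a::topological_space \<Rightarrow>\<^sub>C real"
  by (simp add: abs_bcontfun_def abs_real_def)


section \<open>Ideals and bands in vector lattices\<close>

class vector_lattice = ordered_real_vector + lattice_ab_group_add_abs

instance bcontfun ::
  (topological_space, "{real_normed_vector, ordered_real_vector, linorder_topology}")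
  vector_lattice ..

definition order_ideal :: "'e::vector_lattice set \<Rightarrow> bool"
  where "order_ideal Y \<longleftrightarrow> subspace Y \<and> (\<forall>x. \<forall>y\<in>Y. \<bar>x\<bar> \<le> \<bar>y\<bar> \<longrightarrow> x \<in> Y)"

definition directed_preorder :: "'i set \<Rightarrow> ('i \<Rightarrow> 'i \<Rightarrow> bool) \<Rightarrow> bool"
  where "directed_preorder I r \<longleftrightarrow>
    I \<noteq> {} \<and> reflp_on I r \<and> transp_on I r \<and> (\<forall>i\<in>I. \<forall>j\<in>I. \<exists>k\<in>I. r i k \<and> r j k)"

definition increasing_net :: "'i set \<Rightarrow> ('i \<Rightarrow> 'i \<Rightarrow> bool) \<Rightarrow> ('i \<Rightarrow> 'e::order) \<Rightarrow> bool"
  where "increasing_net I r x \<longleftrightarrow> directed_preorder I r \<and> monotone_on I r (\<le>) x"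

text \<open>
  A definition cannot quantify over the type of the indices of a net. Index sets contained in
  the type \<^typ>\<open>'e\<close> of the vector lattice suffice, since an increasing net may be reindexed by
  its own range; the lemma \<open>band_net_closed\<close> below gives the closure property for arbitrary
  index types.
\<close>

definition band :: "'e::vector_lattice set \<Rightarrow> bool"
  where "band B \<longleftrightarrow> order_ideal B \<and>
    (\<forall>(I :: 'e set) r x s.
      increasing_net I r x \<and> (\<forall>i\<in>I. x i \<in> B \<and> 0 \<le> x i) \<and> isLub UNIV (x ` I) s \<longrightarrow> s \<in> B)"

lemma band_net_closed:
  fixes B :: "'e::vector_lattice set" and I :: "'i set"
  assumes "band B" and net: "increasing_net I r x"
    and mem: "\<And>i. i \<in> I \<Longrightarrow> x i \<in> B \<and> 0 \<le> x i"
    and lub: "isLub UNIV (x ` I) s"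
  shows "s \<in> B"
proof -
  have "increasing_net (x ` I) (\<le>) (\<lambda>e. e)"
    unfolding increasing_net_def directed_preorder_def
  proof (intro conjI)
    show "\<forall>a\<in>x ` I. \<forall>b\<in>x ` I. \<exists>c\<in>x ` I. a \<le> c \<and> b \<le> c"
    proof clarify
      fix i j
      assume "i \<in> I" "j \<in> I"
      then obtain k where "k \<in> I" "r i k" "r j k"
        using net unfolding increasing_net_def directed_preorder_def by blast
      then have "x i \<le> x k" "x j \<le> x k"
        using net \<open>i \<in> I\<close> \<open>j \<in> I\<close> unfolding increasing_net_def monotone_on_def by blast+
      then show "\<exists>c\<in>x ` I. x i \<le> c \<and> x j \<le> c"
        using \<open>k \<in> I\<close> by blast
    qed
    show "x ` I \<noteq> {}"
      using net by (simp add: increasing_net_def directed_preorder_def)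
    show "reflp_on (x ` I) (\<le>)" "transp_on (x ` I) (\<le>)" "monotone_on (x ` I) (\<le>) (\<le>) (\<lambda>e. e)"
      by (auto intro: reflp_onI transp_onI monotone_onI order_trans)
  qed
  moreover have "\<forall>e\<in>x ` I. e \<in> B \<and> 0 \<le> e"
    using mem by auto
  moreover have "isLub UNIV ((\<lambda>e. e) ` x ` I) s"
    using lub by simp
  ultimately show ?thesis
    using \<open>band B\<close> unfolding band_def by blast
qed

definition disjoint_complement :: "'e::vector_lattice set \<Rightarrow> 'e set"
  where "disjoint_complement B = {x. \<forall>b\<in>B. inf \<bar>x\<bar> \<bar>b\<bar> = 0}"

definition projection_band :: "'e::vector_lattice set \<Rightarrow> bool"
  where "projection_band B \<longleftrightarrow> band B \<and>
    (\<forall>x. \<exists>!(b, c). b \<in> B \<and> c \<in> disjoint_complement B \<and> x = b + c)"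

definition J :: "'a::topological_space set \<Rightarrow> ('a \<Rightarrow>\<^sub>C real) set"
  where "J F = {f. \<forall>x\<in>F. apply_bcontfun f x = 0}"

end

(* The candidate for F is the common zero set of B. Truncating the multiples n e of elements e of B
   shows that every f \<ge> 0 is approximated from below, within B, at each point outside F. An upper
   bound in C_b(X) of these minorants therefore dominates f on the closure of the complement of F,
   that is, off the interior of F. So a band contains every function vanishing on the interior
   of F; complete regularity then forces the interior to be dense in F. For projection bands, the
   component of the constant function 1 in B is the indicator of the complement of F. *)

theory Submission
  imports Defs
begin

section \<open>Pointwise order, disjointness and the ideals \<open>J F\<close>\<close>

lemma abs_bcontfun_le_iff:
  fixes f g :: "'a::topological_space \<Rightarrow>\<^sub>C real"
  shows "\<bar>f\<bar> \<le> \<bar>g\<bar> \<longleftrightarrow> (\<forall>x. \<bar>apply_bcontfun f x\<bar> \<le> \<bar>apply_bcontfun g x\<bar>)"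
  by (simp add: less_eq_bcontfun_def)

lemma bcontfun_eq_iff: "f = g \<longleftrightarrow> (\<forall>x. apply_bcontfun f x = apply_bcontfun g x)"
  by (auto intro: bcontfun_eqI)

lemma mem_disjoint_complement_bcontfun_iff:
  fixes c :: "'a::topological_space \<Rightarrow>\<^sub>C real"
  shows "c \<in> disjoint_complement B \<longleftrightarrow>
    (\<forall>b\<in>B. \<forall>x. apply_bcontfun c x = 0 \<or> apply_bcontfun b x = 0)"
proof -
  have "min \<bar>a\<bar> \<bar>b\<bar> = 0 \<longleftrightarrow> a = 0 \<or> b = 0" for a b :: real
    by (auto simp: min_def)
  then have "inf \<bar>c\<bar> \<bar>b\<bar> = 0 \<longleftrightarrow> (\<forall>x. apply_bcontfun c x = 0 \<or> apply_bcontfun b x = 0)"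
    for b :: "'a \<Rightarrow>\<^sub>C real"
    unfolding bcontfun_eq_iff by simp
  then show ?thesis
    by (simp add: disjoint_complement_def)
qed

lemma order_ideal_J:
  fixes F :: "'a::topological_space set"
  shows "order_ideal (J F)"
  unfolding order_ideal_def abs_bcontfun_le_iff
proof (intro conjI allI ballI impI)
  show "subspace (J F)"
    by (simp add: J_def subspace_def)
  fix f g :: "'a \<Rightarrow>\<^sub>C real"
  assume "g \<in> J F" and le: "\<forall>x. \<bar>apply_bcontfun f x\<bar> \<le> \<bar>apply_bcontfun g x\<bar>"
  then have "apply_bcontfun f x = 0" if "x \<in> F" for x
    using that le[rule_format, of x] by (simp add: J_def)
  then show "f \<in> J F"
    by (simp add: J_def)
qed

section \<open>Bump functions and cut-offs on clopen sets\<close>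

lemma completely_regular_bump:
  fixes V :: "'a::topological_space set"
  assumes "completely_regular_space (euclidean :: 'a topology)" "open V" "x \<in> V"
  obtains g :: "'a \<Rightarrow>\<^sub>C real" where "apply_bcontfun g x = 1"
    "\<And>y. 0 \<le> apply_bcontfun g y" "\<And>y. apply_bcontfun g y \<le> 1"
    "\<And>y. y \<notin> V \<Longrightarrow> apply_bcontfun g y = 0"
proof -
  have "closedin euclidean (- V)" "x \<in> topspace euclidean - - V"
    using assms by auto
  then obtain f :: "'a \<Rightarrow> real" where f: "continuous_map euclidean (top_of_set {0..1}) f"
    "f x = 0" "f ` (- V) \<subseteq> {1}"
    using assms(1)[unfolded completely_regular_space_def, rule_format] by metis
  then have cont: "continuous_on UNIV f" and range: "\<And>y. f y \<in> {0..1}"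
    by (auto simp: continuous_map_in_subtopology)
  \<comment> \<open>The separating function \<open>f\<close> is 0 at \<open>x\<close> and 1 off
    \<open>V\<close>, so the bump is its reflection \<open>1 - f\<close>.\<close>
  have "(\<lambda>y. 1 - f y) \<in> bcontfun"
    using range by (intro bcontfun_normI[where b = 1]) (auto intro!: continuous_intros cont)
  then have "apply_bcontfun (Bcontfun (\<lambda>y. 1 - f y)) = (\<lambda>y. 1 - f y)"
    by (rule Bcontfun_inverse)
  then show thesis
    using f(2,3) range by (intro that[of "Bcontfun (\<lambda>y. 1 - f y)"]) (simp_all add: image_subset_iff)
qed

lemma clopen_restriction:
  fixes f :: "'a::topological_space \<Rightarrow>\<^sub>C 'b::real_normed_vector"
  assumes "open U" "closed U"
  obtains g :: "'a \<Rightarrow>\<^sub>C 'b"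
  where "\<And>x. apply_bcontfun g x = (if x \<in> U then apply_bcontfun f x else 0)"
proof -
  let ?g = "\<lambda>x. if x \<in> U then apply_bcontfun f x else 0"
  have "continuous_on (U \<union> - U) ?g"
    using assms by (intro continuous_on_If) (auto intro!: continuous_intros)
  then have "?g \<in> bcontfun"
    by (intro bcontfun_normI[where b = "norm f"]) (auto intro: norm_bounded)
  then show thesis
    by (intro that[of "Bcontfun ?g"]) (simp add: Bcontfun_inverse)
qed

section \<open>Recovering a band from its common zeros\<close>

definition common_zeros :: "('a::topological_space \<Rightarrow>\<^sub>C real) set \<Rightarrow> 'a set"
  where "common_zeros B = {x. \<forall>b\<in>B. apply_bcontfun b x = 0}"

lemma closed_common_zeros: "closed (common_zeros B)"
proof -
  have "common_zeros B = (\<Inter>b\<in>B. {x. apply_bcontfun b x = 0})"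
    by (auto simp: common_zeros_def)
  then show ?thesis
    by (auto intro!: closed_INT closed_Collect_eq continuous_intros)
qed

lemma subset_J_common_zeros: "B \<subseteq> J (common_zeros B)"
  by (auto simp: J_def common_zeros_def)

text \<open>Some \<open>b\<close> in \<open>B\<close> is nonzero at \<open>y\<close>, and for large
  \<open>n\<close> the truncation of \<open>f\<close> at \<open>n\<close> times
  \<open>\<bar>b\<bar>\<close> is a minorant of \<open>f\<close> in \<open>B\<close> that agrees
  with \<open>f\<close> at \<open>y\<close>. The bound \<open>k\<close> itself may lie outside
  \<open>B\<close>.\<close>

lemma order_ideal_upper_bound_ge:
  fixes B :: "('a::topological_space \<Rightarrow>\<^sub>C real) set"
  assumes B: "order_ideal B" and f: "0 \<le> f" and "y \<notin> common_zeros B"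
    and ub: "\<And>h. h \<in> B \<Longrightarrow> 0 \<le> h \<Longrightarrow> h \<le> f \<Longrightarrow> h \<le> k"
  shows "apply_bcontfun f y \<le> apply_bcontfun k y"
proof -
  obtain b where b: "b \<in> B" "apply_bcontfun b y \<noteq> 0"
    using assms(3) by (auto simp: common_zeros_def)
  obtain n :: nat where n: "apply_bcontfun f y < of_nat n * \<bar>apply_bcontfun b y\<bar>"
    using b ex_less_of_nat_mult by (metis zero_less_abs_iff)
  define h where "h = inf f (real n *\<^sub>R \<bar>b\<bar>)"
  have "real n *\<^sub>R b \<in> B"
    using B b(1) by (simp add: order_ideal_def subspace_def)
  \<comment> \<open>Since \<open>f\<close> is nonnegative, \<open>h\<close> lies between 0 and
    \<open>n\<close> times \<open>\<bar>b\<bar>\<close>, so solidity of the ideal applies.\<close>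
  moreover have "\<bar>h\<bar> \<le> \<bar>real n *\<^sub>R b\<bar>"
    using f unfolding abs_bcontfun_le_iff less_eq_bcontfun_def
    by (auto simp: h_def abs_mult min_def)
  ultimately have "h \<in> B"
    using B unfolding order_ideal_def by blast
  moreover have "0 \<le> h" "h \<le> f"
    using f by (auto simp: h_def less_eq_bcontfun_def)
  ultimately have "h \<le> k"
    by (rule ub)
  moreover have "apply_bcontfun h y = apply_bcontfun f y"
    using n by (simp add: h_def)
  ultimately show ?thesis
    by (metis less_eq_bcontfun_def)
qed

text \<open>The minorants of \<open>f\<close> in \<open>B\<close> form an increasing net indexed by
  itself. Membership in a band thus reduces to a statement about suprema, with no net to
  construct.\<close>

lemma band_minorants:
  fixes B :: "'e::vector_lattice set"
  assumes "band B" "0 \<le> f" "isLub UNIV {h \<in> B. 0 \<le> h \<and> h \<le> f} f"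
  shows "f \<in> B"
proof (rule band_net_closed[OF assms(1)])
  let ?D = "{h \<in> B. 0 \<le> h \<and> h \<le> f}"
  have B: "subspace B" "\<And>x y. y \<in> B \<Longrightarrow> \<bar>x\<bar> \<le> \<bar>y\<bar> \<Longrightarrow> x \<in> B"
    using assms(1) unfolding band_def order_ideal_def by blast+
  show "increasing_net ?D (\<le>) (\<lambda>h. h)"
    unfolding increasing_net_def directed_preorder_def
  proof (intro conjI ballI)
    show "?D \<noteq> {}"
      using B(1) assms(2) subspace_0 by blast
    fix g h assume "g \<in> ?D" "h \<in> ?D"
    then have gh: "g \<in> B" "0 \<le> g" "g \<le> f" "h \<in> B" "0 \<le> h" "h \<le> f"
      by auto
    have "0 \<le> sup g h"
      using gh(2) by (rule le_supI1)
    \<comment> \<open>Directedness: for nonnegative \<open>g\<close> and \<open>h\<close> the sum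
      dominates the supremum, so solidity puts the supremum in \<open>B\<close>.\<close>
    moreover have "sup g h \<le> g + h"
      using gh by (intro le_supI) (simp_all only: le_add_same_cancel1 le_add_same_cancel2)
    ultimately have "\<bar>sup g h\<bar> \<le> \<bar>g + h\<bar>"
      by (metis abs_of_nonneg order_trans)
    moreover have "g + h \<in> B"
      using B(1) gh by (simp add: subspace_add)
    ultimately have "sup g h \<in> B"
      by (rule B(2)[rotated])
    then show "\<exists>k\<in>?D. g \<le> k \<and> h \<le> k"
      using gh \<open>0 \<le> sup g h\<close> by (intro bexI[of _ "sup g h"]) simp_all
  qed (auto intro: reflp_onI transp_onI monotone_onI order_trans)
  show "isLub UNIV ((\<lambda>h. h) ` ?D) f"
    using assms(3) by simp
qed auto

lemma band_J_interior_common_zeros: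
  fixes B :: "('a::topological_space \<Rightarrow>\<^sub>C real) set"
  assumes "band B"
  shows "J (interior (common_zeros B)) \<subseteq> B"
proof
  fix f :: "'a \<Rightarrow>\<^sub>C real"
  assume f: "f \<in> J (interior (common_zeros B))"
  have B: "order_ideal B"
    using assms by (simp add: band_def)
  then have "0 \<in> B"
    by (simp add: order_ideal_def subspace_def)
  have "\<bar>f\<bar> \<le> k" if k: "\<And>h. h \<in> B \<Longrightarrow> 0 \<le> h \<Longrightarrow> h \<le> \<bar>f\<bar> \<Longrightarrow> h \<le> k" for k
  proof -
    have "closed {x. apply_bcontfun \<bar>f\<bar> x \<le> apply_bcontfun k x}"
      by (intro closed_Collect_le continuous_on_apply_bcontfun continuous_on_id)
    moreover have "- common_zeros B \<subseteq> {x. apply_bcontfun \<bar>f\<bar> x \<le> apply_bcontfun k x}"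
      using order_ideal_upper_bound_ge[OF B abs_ge_zero _ k] by blast
    ultimately have "closure (- common_zeros B) \<subseteq> {x. apply_bcontfun \<bar>f\<bar> x \<le> apply_bcontfun k x}"
      by (simp add: closure_minimal)
    \<comment> \<open>On the interior \<open>\<bar>f\<bar>\<close> vanishes, so it suffices there
      that \<open>k\<close> is nonnegative; this holds because 0 is one of the minorants.\<close>
    moreover have "0 \<le> apply_bcontfun k x" for x
      using k[OF \<open>0 \<in> B\<close>] by (simp add: less_eq_bcontfun_def)
    moreover have "apply_bcontfun \<bar>f\<bar> x = 0" if "x \<in> interior (common_zeros B)" for x
      using f that by (simp add: J_def)
    ultimately show ?thesis
      unfolding less_eq_bcontfun_def closure_complement
      by (metis ComplI mem_Collect_eq subsetD)
  qed
  then have "isLub UNIV {h \<in> B. 0 \<le> h \<and> h \<le> \<bar>f\<bar>} \<bar>f\<bar>"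
    by (auto simp: isLub_def leastP_def isUb_def setle_def setge_def)
  then have "\<bar>f\<bar> \<in> B"
    using assms by (intro band_minorants) auto
  then show "f \<in> B"
    using B unfolding order_ideal_def by (metis abs_idempotent order_refl)
qed

text \<open>Shrinking a set enlarges its \<open>J\<close>, so the ideals close up in a circle:
  \<open>B\<close> lies in \<open>J\<close> of the common zeros, which lies in \<open>J\<close> of
  their interior, which lies in \<open>B\<close>.\<close>

lemma band_imp_J:
  fixes B :: "('a::topological_space \<Rightarrow>\<^sub>C real) set"
  assumes "band B"
  shows "B = J (common_zeros B)"
proof
  have "J (common_zeros B) \<subseteq> J (interior (common_zeros B))"
    using interior_subset by (fastforce simp: J_def)
  also have "\<dots> \<subseteq> B"
    using assms by (rule band_J_interior_common_zeros)
  finally show "J (common_zeros B) \<subseteq> B" .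
qed (rule subset_J_common_zeros)

text \<open>At a common zero outside the closure of the interior, a bump vanishing on that closure
  would belong to \<open>B\<close> without vanishing at the point.\<close>

lemma band_imp_regular_closed:
  fixes B :: "('a::topological_space \<Rightarrow>\<^sub>C real) set"
  assumes "completely_regular_space (euclidean :: 'a topology)" "band B"
  shows "common_zeros B = closure (interior (common_zeros B))"
proof
  show "closure (interior (common_zeros B)) \<subseteq> common_zeros B"
    by (simp add: closure_minimal closed_common_zeros interior_subset)
  show "common_zeros B \<subseteq> closure (interior (common_zeros B))"
  proof (rule ccontr)
    assume "\<not> ?thesis"
    then obtain x where x: "x \<in> common_zeros B" "x \<in> - closure (interior (common_zeros B))"
      by blast
    obtain g :: "'a \<Rightarrow>\<^sub>C real" where g: "apply_bcontfun g x = 1"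
      "\<And>y. y \<notin> - closure (interior (common_zeros B)) \<Longrightarrow> apply_bcontfun g y = 0"
      using completely_regular_bump[OF assms(1) _ x(2)] by (metis closed_closure open_Compl)
    then have "g \<in> J (interior (common_zeros B))"
      using closure_subset by (fastforce simp: J_def)
    then have "g \<in> B"
      using band_J_interior_common_zeros[OF assms(2)] by blast
    then show False
      using x(1) g(1) by (auto simp: common_zeros_def)
  qed
qed

section \<open>Bands from regular closed sets\<close>

text \<open>Suprema in \<open>C_b(X)\<close> need not be pointwise, so \<open>s\<close> might a
  priori be nonzero on \<open>F\<close>. Bumps inside the interior of \<open>F\<close> yield upper
  bounds that force \<open>s\<close> to vanish there, and continuity carries this to the
  closure.\<close>

lemma regular_closed_imp_band_J:
  fixes F :: "'a::topological_space set"
  assumes cr: "completely_regular_space (euclidean :: 'a topology)"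
    and F: "F = closure (interior F)"
  shows "band (J F)"
  unfolding band_def
proof (intro conjI allI impI order_ideal_J)
  fix I :: "('a \<Rightarrow>\<^sub>C real) set" and r x s
  assume "increasing_net I r x \<and> (\<forall>i\<in>I. x i \<in> J F \<and> 0 \<le> x i) \<and> isLub UNIV (x ` I) s"
  then have "I \<noteq> {}" and x: "\<And>i. i \<in> I \<Longrightarrow> x i \<in> J F" "\<And>i. i \<in> I \<Longrightarrow> 0 \<le> x i"
    and ub: "\<And>i. i \<in> I \<Longrightarrow> x i \<le> s"
    and least: "\<And>k. (\<And>i. i \<in> I \<Longrightarrow> x i \<le> k) \<Longrightarrow> s \<le> k"
    by (auto simp: increasing_net_def directed_preorder_def isLub_def leastP_def isUb_def
        setle_def setge_def)
  then have s: "0 \<le> s"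
    by (meson ex_in_conv order_trans)
  have zero: "apply_bcontfun s y = 0" if y: "y \<in> interior F" for y
  proof -
    obtain g :: "'a \<Rightarrow>\<^sub>C real" where g: "apply_bcontfun g y = 1"
      "\<And>z. apply_bcontfun g z \<le> 1" "\<And>z. z \<notin> interior F \<Longrightarrow> apply_bcontfun g z = 0"
      using completely_regular_bump[OF cr open_interior y] by metis
    \<comment> \<open>This competitor is nonnegative, equals \<open>norm s\<close> off the interior
      of \<open>F\<close> and is 0 at \<open>y\<close>. It bounds the net, whose members vanish on
      \<open>F\<close> and are at most \<open>s\<close> elsewhere.\<close>
    define k where "k = norm s *\<^sub>R (const_bcontfun 1 - g)"
    have "x i \<le> k" if "i \<in> I" for i
      unfolding less_eq_bcontfun_def
    proof
      fix z
      show "apply_bcontfun (x i) z \<le> apply_bcontfun k z"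
      proof (cases "z \<in> interior F")
        case True
        then have "apply_bcontfun (x i) z = 0"
          using x(1)[OF that] interior_subset by (auto simp: J_def)
        then show ?thesis
          using g(2)[of z] by (simp add: k_def const_bcontfun.rep_eq)
      next
        case False
        have "apply_bcontfun (x i) z \<le> apply_bcontfun s z"
          using ub[OF that] by (simp add: less_eq_bcontfun_def)
        also have "\<dots> \<le> norm s"
          using norm_bounded[of s z] by simp
        finally show ?thesis
          using g(3)[OF False] by (simp add: k_def const_bcontfun.rep_eq)
      qed
    qed
    then have "s \<le> k"
      by (rule least)
    then have "apply_bcontfun s y \<le> apply_bcontfun k y" "0 \<le> apply_bcontfun s y"
      using s by (simp_all add: less_eq_bcontfun_def)
    then show ?thesis
      using g(1) by (simp add: k_def const_bcontfun.rep_eq)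
  qed
  have "closed {y. apply_bcontfun s y = 0}"
    by (intro closed_Collect_eq continuous_on_apply_bcontfun continuous_on_const continuous_on_id)
  then have "closure (interior F) \<subseteq> {y. apply_bcontfun s y = 0}"
    using zero by (intro closure_minimal) auto
  then show "s \<in> J F"
    using F by (auto simp: J_def)
qed

section \<open>Projection bands and clopen sets\<close>

text \<open>In the splitting 1 = \<open>b + c\<close>, the part \<open>c\<close> vanishes wherever
  some member of \<open>B\<close> does not. So \<open>b\<close> is a continuous indicator of the
  complement of the common zeros.\<close>

lemma projection_band_imp_open_common_zeros:
  fixes B :: "('a::topological_space \<Rightarrow>\<^sub>C real) set"
  assumes "projection_band B"
  shows "open (common_zeros B)"
proof -
  have "\<exists>!(b, c). b \<in> B \<and> c \<in> disjoint_complement B \<and> const_bcontfun 1 = b + c"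
    using assms unfolding projection_band_def by blast
  then obtain b c where b: "b \<in> B" and c: "c \<in> disjoint_complement B"
    and eq: "const_bcontfun 1 = b + c"
    by auto
  have sum: "1 = apply_bcontfun b x + apply_bcontfun c x" for x
    using arg_cong[OF eq, of "\<lambda>f. apply_bcontfun f x"] by (simp add: const_bcontfun.rep_eq)
  have "apply_bcontfun c x = 0" if "x \<notin> common_zeros B" for x
    using that c by (auto simp: common_zeros_def mem_disjoint_complement_bcontfun_iff)
  then have "apply_bcontfun b x = 1" if "x \<notin> common_zeros B" for x
    using that sum[of x] by simp
  moreover have "apply_bcontfun b x = 0" if "x \<in> common_zeros B" for x
    using that b by (auto simp: common_zeros_def)
  ultimately have "common_zeros B = {x. apply_bcontfun b x < 1}"
    by force
  then show ?thesis
    by (simp add: open_Collect_less)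
qed

lemma clopen_imp_projection_band_J:
  fixes F :: "'a::topological_space set"
  assumes cr: "completely_regular_space (euclidean :: 'a topology)"
    and F: "closed F" "open F"
  shows "projection_band (J F)"
  unfolding projection_band_def
proof (intro conjI allI)
  show "band (J F)"
    using F by (intro regular_closed_imp_band_J[OF cr]) (simp add: interior_open)
  have U: "open (- F)" "closed (- F)"
    using F by auto
  \<comment> \<open>The indicator \<open>e\<close> of the complement of \<open>F\<close> is a single
    member of \<open>J F\<close> that tests disjointness at every point off
    \<open>F\<close>.\<close>
  obtain e :: "'a \<Rightarrow>\<^sub>C real" where
    e: "\<And>x. apply_bcontfun e x = (if x \<in> - F then apply_bcontfun (const_bcontfun 1) x else 0)"
    using clopen_restriction[OF U] by metis
  have e_J: "e \<in> J F"
    by (simp add: J_def e)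
  have e_1: "apply_bcontfun e x = 1" if "x \<notin> F" for x
    using that by (simp add: e const_bcontfun.rep_eq)
  have dc: "c \<in> disjoint_complement (J F) \<longleftrightarrow> (\<forall>x. x \<notin> F \<longrightarrow> apply_bcontfun c x = 0)" for c
  proof
    assume "c \<in> disjoint_complement (J F)"
    then have "apply_bcontfun c x = 0 \<or> apply_bcontfun e x = 0" for x
      using e_J unfolding mem_disjoint_complement_bcontfun_iff by blast
    then show "\<forall>x. x \<notin> F \<longrightarrow> apply_bcontfun c x = 0"
      using e_1 by (metis zero_neq_one)
  qed (auto simp: mem_disjoint_complement_bcontfun_iff J_def)
  fix f :: "'a \<Rightarrow>\<^sub>C real"
  obtain b where b: "\<And>x. apply_bcontfun b x = (if x \<in> - F then apply_bcontfun f x else 0)"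
    using clopen_restriction[OF U] by metis
  \<comment> \<open>On \<open>F\<close> both \<open>b'\<close> and \<open>b\<close> are 0; off
    \<open>F\<close> the part \<open>c'\<close> is 0, so both agree with \<open>f\<close>.\<close>
  have unique: "b' = b" if "b' \<in> J F" "c' \<in> disjoint_complement (J F)" "f = b' + c'" for b' c'
  proof (rule bcontfun_eqI)
    fix x
    show "apply_bcontfun b' x = apply_bcontfun b x"
      using that(1,2) unfolding b that(3) dc by (simp add: J_def)
  qed
  show "\<exists>!(b, c). b \<in> J F \<and> c \<in> disjoint_complement (J F) \<and> f = b + c"
  proof (rule ex1I[of _ "(b, f - b)"])
    show "case (b, f - b) of (b, c) \<Rightarrow> b \<in> J F \<and> c \<in> disjoint_complement (J F) \<and> f = b + c"
      unfolding dc by (simp add: J_def b)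
    show "p = (b, f - b)"
      if "case p of (b, c) \<Rightarrow> b \<in> J F \<and> c \<in> disjoint_complement (J F) \<and> f = b + c" for p
    proof -
      obtain b' c' where p: "p = (b', c')"
        by fastforce
      then have "b' = b" "f = b' + c'"
        using that unique[of b' c'] by simp_all
      then show ?thesis
        using p by simp
    qed
  qed
qed

theorem theorem5p3:
  fixes B :: "('a::t2_space \<Rightarrow>\<^sub>C real) set"
  assumes "completely_regular_space (euclidean :: 'a topology)"
    and "order_ideal B" and "closed B"
  shows "(band B \<longleftrightarrow> (\<exists>F. closed F \<and> F = closure (interior F) \<and> B = J F)) \<and>
         (projection_band B \<longleftrightarrow> (\<exists>F. closed F \<and> open F \<and> B = J F))"
proof (intro conjI iffI)
  assume "band B"
  then show "\<exists>F. closed F \<and> F = closure (interior F) \<and> B = J F"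
    by (intro exI[of _ "common_zeros B"] conjI closed_common_zeros band_imp_J
        band_imp_regular_closed[OF assms(1)])
next
  assume "projection_band B"
  then show "\<exists>F. closed F \<and> open F \<and> B = J F"
    by (intro exI[of _ "common_zeros B"] conjI closed_common_zeros band_imp_J
        projection_band_imp_open_common_zeros) (simp_all add: projection_band_def)
next
  assume "\<exists>F. closed F \<and> F = closure (interior F) \<and> B = J F"
  then show "band B"
    by (elim exE conjE, hypsubst) (rule regular_closed_imp_band_J[OF assms(1)])
next
  assume "\<exists>F. closed F \<and> open F \<and> B = J F"
  then show "projection_band B"
    using clopen_imp_projection_band_J[OF assms(1)] by blast
qed

end
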